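(* For all $n\geq 1$, $$\mathrm{pspa}(8n+2)\equiv \mathrm{pspa}(8n-5)\pmod 2 \quad\text{and}\quad \mathrm{pspa}'(8n+2)\equiv \mathrm{pspa}'(8n-5)\pmod 2.$$
   Context: For $n\ge1$, $\mathrm{pspa}(n)$ (respectively $\mathrm{pspa}'(n)$) denotes the total number of parts (counted with multiplicity) in all the partitions in $\mathcal{SP}a(n)$ (respectively $\mathcal{SP}a'(n)$), defined as follows. A partition of $n$ is a weakly decreasing sequence (equivalently, a finite multiset) of positive integers with sum $n$. $\lambda\sqcup\mu$ is the partition whose multiset of parts is the multiset union (multiplicities added) of the parts of $\lambda$ and $\mu$; $2\lambda$ is obtained by doubling every part; if $\lambda$ has an odd part, $\lambda^{o+2}$ is obtained by adding $2$ to (one occurrence of) the largest odd part of $\lambda$. These operations are applied elementwise to sets of partitions (giving $\emptyset$ for the empty set). Semi-Padovan partitions: $\mathcal{SP}a(0)=\{(\,)\}$ (the set containing the empty partition), $\mathcal{SP}a(1)=\emptyset$, $\mathcal{SP}a(3)=\{(3)\}$, $\mathcal{SP}a(2n)=2\,\mathcal{SP}a(n)$ for $n\ge1$, and $\mathcal{SP}a(2n+1)=\mathcal{SP}a(2n-1)^{o+2}\cup\big(\mathcal{SP}a(2n-2)\sqcup(1,1,1)\big)$ for $n\ge2$. Modified semi-Padovan partitions: $\mathcal{SP}a'(0)=\emptyset$, $\mathcal{SP}a'(1)=\{(1)\}$, and for $n\ge1$: $\mathcal{SP}a'(2n)=2\,\mathcal{SP}a'(n)$ and $\mathcal{SP}a'(2n+1)=\mathcal{SP}a'(2n-1)^{o+2}\cup\big(\mathcal{SP}a'(2n-2)\sqcup(1,1,1)\big)$.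 *)

theory Defs
  imports "HOL-Library.Multiset" "HOL-Number_Theory.Cong"
begin

text \<open>Partitions are finite multisets of positive naturals; the union of two partitions with
  multiplicities added is multiset addition.\<close>

definition double_parts :: "nat multiset \<Rightarrow> nat multiset" where
  "double_parts l = image_mset (\<lambda>p. 2 * p) l"

text \<open>If there is no odd part, the operation is undefined in the source; the value chosen here never
  matters, since it is only applied to partitions of odd numbers
  (see \<open>SPa_partition\<close> and \<open>SPa'_partition\<close> below).\<close>

definition odd_plus2 :: "nat multiset \<Rightarrow> nat multiset" where
  "odd_plus2 l =
     (if \<exists>p\<in>#l. odd p
      then let m = Max {p \<in> set_mset l. odd p} in add_mset (m + 2) (l - {#m#})
      else l)"

function SPa :: "nat \<Rightarrow> nat multiset set" where
  "SPa 0 = {{#}}"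
| "SPa 1 = {}"
| "SPa 3 = {{#3#}}"
| "n \<ge> 1 \<Longrightarrow> SPa (2 * n) = double_parts ` SPa n"
| "n \<ge> 2 \<Longrightarrow> SPa (2 * n + 1) =
     odd_plus2 ` SPa (2 * n - 1) \<union> (\<lambda>l. l + {#1, 1, 1#}) ` SPa (2 * n - 2)"
proof -
  fix P :: bool and x :: nat
  assume a: "x = 0 \<Longrightarrow> P" "x = 1 \<Longrightarrow> P" "x = 3 \<Longrightarrow> P"
    "\<And>n. 1 \<le> n \<Longrightarrow> x = 2 * n \<Longrightarrow> P" "\<And>n. 2 \<le> n \<Longrightarrow> x = 2 * n + 1 \<Longrightarrow> P"
  have "x = 0 \<or> x = 1 \<or> x = 3 \<or> (\<exists>n\<ge>1. x = 2 * n) \<or> (\<exists>n\<ge>2. x = 2 * n + 1)"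
    by presburger
  then show P using a by blast
qed ((simp; fail) | (rule FalseE, presburger))+
termination by (relation "measure id") auto

function SPa' :: "nat \<Rightarrow> nat multiset set" where
  "SPa' 0 = {}"
| "SPa' 1 = {{#1#}}"
| "n \<ge> 1 \<Longrightarrow> SPa' (2 * n) = double_parts ` SPa' n"
| "n \<ge> 1 \<Longrightarrow> SPa' (2 * n + 1) =
     odd_plus2 ` SPa' (2 * n - 1) \<union> (\<lambda>l. l + {#1, 1, 1#}) ` SPa' (2 * n - 2)"
proof -
  fix P :: bool and x :: nat
  assume a: "x = 0 \<Longrightarrow> P" "x = 1 \<Longrightarrow> P"
    "\<And>n. 1 \<le> n \<Longrightarrow> x = 2 * n \<Longrightarrow> P" "\<And>n. 1 \<le> n \<Longrightarrow> x = 2 * n + 1 \<Longrightarrow> P"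
  have "x = 0 \<or> x = 1 \<or> (\<exists>n\<ge>1. x = 2 * n) \<or> (\<exists>n\<ge>1. x = 2 * n + 1)"
    by presburger
  then show P using a by blast
qed ((simp; fail) | (rule FalseE, presburger))+
termination by (relation "measure id") auto

lemma sum_double_parts: "sum_mset (double_parts l) = 2 * sum_mset l"
  unfolding double_parts_def by (induction l) auto

lemma odd_part_exists:
  fixes l :: "nat multiset"
  assumes "odd (sum_mset l)"
  shows "\<exists>p\<in>#l. odd p"
  using assms by (induction l) auto

lemma odd_plus2_partition:
  assumes "odd (sum_mset l)" "0 \<notin># l"
  shows "sum_mset (odd_plus2 l) = sum_mset l + 2" "0 \<notin># odd_plus2 l"
proof -
  let ?S = "{p \<in> set_mset l. odd p}"
  define m where "m = Max ?S"
  have ex: "\<exists>p\<in>#l. odd p" by (rule odd_part_exists[OF assms(1)])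
  then have "m \<in> ?S" unfolding m_def by (intro Max_in) auto
  then obtain l' where l: "l = add_mset m l'" by (auto dest: multi_member_split)
  have eq: "odd_plus2 l = add_mset (m + 2) (l - {#m#})"
    using ex by (simp add: odd_plus2_def Let_def m_def)
  show "sum_mset (odd_plus2 l) = sum_mset l + 2" "0 \<notin># odd_plus2 l"
    using assms unfolding eq by (auto simp: l)
qed

lemma SPa_partition: "l \<in> SPa n \<Longrightarrow> sum_mset l = n \<and> 0 \<notin># l"
proof (induction n arbitrary: l rule: SPa.induct)
  case (4 n)
  show ?case
    using "4.IH" "4.prems" unfolding SPa.simps(4)[OF "4.hyps"]
    by (auto simp: sum_double_parts) (auto simp: double_parts_def)
next
  case (5 n)
  have "odd (2 * n - 1)" "2 * n - 1 + 2 = 2 * n + 1" "2 * n - 2 + 3 = 2 * n + 1"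
    using "5.hyps" by auto
  then show ?case
    using "5.IH" "5.prems" unfolding SPa.simps(5)[OF "5.hyps"]
    by (auto simp: odd_plus2_partition)
qed (auto simp del: One_nat_def)

lemma SPa'_partition: "l \<in> SPa' n \<Longrightarrow> sum_mset l = n \<and> 0 \<notin># l"
proof (induction n arbitrary: l rule: SPa'.induct)
  case (3 n)
  show ?case
    using "3.IH" "3.prems" unfolding SPa'.simps(3)[OF "3.hyps"]
    by (auto simp: sum_double_parts) (auto simp: double_parts_def)
next
  case (4 n)
  have "odd (2 * n - 1)" "2 * n - 1 + 2 = 2 * n + 1" "2 * n - 2 + 3 = 2 * n + 1"
    using "4.hyps" by auto
  then show ?case
    using "4.IH" "4.prems" unfolding SPa'.simps(4)[OF "4.hyps"]
    by (auto simp: odd_plus2_partition)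
qed (auto simp del: One_nat_def)

lemma finite_SPa: "finite (SPa n)"
  by (induction n rule: SPa.induct) (auto simp del: One_nat_def)

lemma finite_SPa': "finite (SPa' n)"
  by (induction n rule: SPa'.induct) (auto simp del: One_nat_def)

definition pspa :: "nat \<Rightarrow> nat" where
  "pspa n = (\<Sum>l\<in>SPa n. size l)"

definition pspa' :: "nat \<Rightarrow> nat" where
  "pspa' n = (\<Sum>l\<in>SPa' n. size l)"

end

theory Submission
  imports Defs
begin

text \<open>Write \<open>p n\<close> for the number of parts in all partitions of \<open>n\<close> of the given kind and \<open>c n\<close> for
  \<open>p n\<close> plus the number of those partitions. The defining recursion of the sets loses nothing: doubling
  is injective, raising the largest odd part by \<open>2\<close> can be undone, and the partitions it yields have
  an odd part at least \<open>3\<close>, whereas in those obtained by adjoining \<open>(1,1,1)\<close> to a partition into even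
  parts the only odd part is \<open>1\<close> (\<open>card_step\<close>, \<open>sum_size_step\<close>). Since adjoining \<open>(1,1,1)\<close> adds
  three parts, reduction modulo \<open>2\<close> turns the recursion into
  \<open>p (2 * m + 3) - p (2 * m + 1) \<equiv> c m\<close> and \<open>c (2 * m + 3) - c (2 * m + 1) \<equiv> p m\<close>, with \<open>p (2 * m) = p m\<close>
  and \<open>c (2 * m) = c m\<close>: a system in which \<open>p\<close> and \<open>c\<close> play interchanged roles.

  Both families of partitions satisfy this system and have \<open>c 1\<close> even, and these facts alone force the
  congruence (\<open>coupled_recursion_congruence\<close>). Since \<open>p 10 = p 5\<close>, the parity of \<open>c 1\<close> is that of
  \<open>p 10 - p 3\<close>, which starts an induction. When \<open>n\<close> grows by \<open>1\<close>, the defect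
  \<open>p (8 * n + 10) - p (8 * n + 3)\<close> changes, modulo \<open>2\<close>, by the two increments
  \<open>c (2 * n + 3) - c (2 * n + 1)\<close> and \<open>c (4 * n + 3) - c (4 * n + 1)\<close>. Both are congruent to \<open>p n\<close>, so
  they cancel.\<close>

lemma coupled_recursion_congruence:
  fixes p c :: "nat \<Rightarrow> nat"
  assumes p_double: "\<And>m. p (2 * m) = p m"
    and c_double: "\<And>m. c (2 * m) = c m"
    and p_odd: "\<And>m. [p (2 * m + 3) = p (2 * m + 1) + c m] (mod 2)"
    and c_odd: "\<And>m. [c (2 * m + 3) = c (2 * m + 1) + p m] (mod 2)"
    and c_1: "even (c 1)"
  shows "[p (8 * n + 10) = p (8 * n + 3)] (mod 2)"
proof -
  have parity: "[a = b] (mod 2) \<longleftrightarrow> even (a + b)" for a b :: nat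
    unfolding cong_def by presburger
  have P: "even (p i + p j + c k)" if "i = 2 * m + 3" "j = 2 * m + 1" "c k = c m" for i j k m
    using p_odd[of m] that by (simp add: parity add_ac)
  have C: "even (c i + c j + p k)" if "i = 2 * m + 3" "j = 2 * m + 1" "p k = p m" for i j k m
    using c_odd[of m] that by (simp add: parity add_ac)
  have "even (p (8 * n + 10) + p (8 * n + 3))"
  proof (induction n)
    case 0
    have "p 10 = p 5" using p_double[of 5] by simp
    moreover have "even (p 5 + p 3 + c 1)"
      by (rule P[where m = 1]) simp_all
    ultimately show ?case using c_1 by simp
  next
    case (Suc n)
    have "p (8 * n + 18) = p (4 * n + 9)" "p (8 * n + 10) = p (4 * n + 5)"
      using p_double[of "4 * n + 9"] p_double[of "4 * n + 5"] by simp_all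
    moreover have "even (p (4 * n + 9) + p (4 * n + 7) + c (2 * n + 3))"
      by (rule P[where m = "2 * n + 3"]) simp_all
    moreover have "even (p (4 * n + 7) + p (4 * n + 5) + c (n + 1))"
      by (rule P[where m = "2 * n + 2"]) (use c_double[of "n + 1"] in simp_all)
    ultimately have upper:
      "even (p (8 * n + 18) + p (8 * n + 10) + (c (2 * n + 3) + c (n + 1)))"
      by (simp only: even_add) argo
    have "even (p (8 * n + 11) + p (8 * n + 9) + c (n + 1))"
      by (rule P[where m = "2 * (2 * (n + 1))"]) (simp, simp, simp only: c_double)
    moreover have "even (p (8 * n + 9) + p (8 * n + 7) + c (4 * n + 3))"
      by (rule P[where m = "4 * n + 3"]) simp_all
    moreover have "even (p (8 * n + 7) + p (8 * n + 5) + c (2 * n + 1))"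
      by (rule P[where m = "4 * n + 2"]) (use c_double[of "2 * n + 1"] in simp_all)
    moreover have "even (p (8 * n + 5) + p (8 * n + 3) + c (4 * n + 1))"
      by (rule P[where m = "4 * n + 1"]) simp_all
    ultimately have lower: "even (p (8 * n + 11) + p (8 * n + 3)
        + (c (n + 1) + c (4 * n + 3) + c (2 * n + 1) + c (4 * n + 1)))"
      by (simp only: even_add) argo
    \<comment> \<open>What remains of the change of the defect are two increments of \<open>c\<close>, which cancel.\<close>
    have "even (c (2 * n + 3) + c (2 * n + 1) + p n)"
      by (rule C) simp_all
    moreover have "even (c (4 * n + 3) + c (4 * n + 1) + p n)"
      by (rule C[where m = "2 * n"]) (simp_all add: p_double)
    ultimately have "even (p (8 * n + 18) + p (8 * n + 11))"
      using Suc.IH upper lower by (simp only: even_add) argo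
    then show ?case by (simp add: add_ac)
  qed
  then show ?thesis by (simp only: parity)
qed

lemma odd_plus2_split:
  assumes "\<exists>p\<in>#l. odd p"
  obtains m l' where "l = add_mset m l'" "odd_plus2 l = add_mset (m + 2) l'" "odd m"
    "\<And>p. p \<in># l' \<Longrightarrow> odd p \<Longrightarrow> p \<le> m"
proof -
  let ?S = "{p \<in> set_mset l. odd p}"
  define m where "m = Max ?S"
  have m: "m \<in> ?S" unfolding m_def using assms by (intro Max_in) auto
  then obtain l' where l: "l = add_mset m l'" by (auto dest: multi_member_split)
  have "odd_plus2 l = add_mset (m + 2) l'"
  proof -
    have "odd_plus2 l = add_mset (m + 2) (l - {#m#})"
      using assms by (simp add: odd_plus2_def Let_def m_def)
    then show ?thesis by (simp add: l)
  qed
  moreover have "p \<le> m" if "p \<in># l'" "odd p" for p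
    unfolding m_def using that by (intro Max_ge) (auto simp: l)
  ultimately show thesis using that l m by blast
qed

text \<open>The raised part is still the largest odd part, so that lowering the largest odd part by \<open>2\<close>
  recovers the original partition.\<close>

lemma inj_on_odd_plus2: "inj_on odd_plus2 {l. \<exists>p\<in>#l. odd p}"
proof (rule inj_onI)
  fix k l
  assume "k \<in> {l. \<exists>p\<in>#l. odd p}" "l \<in> {l. \<exists>p\<in>#l. odd p}"
    and eq: "odd_plus2 k = odd_plus2 l"
  then have ex: "\<exists>p\<in>#k. odd p" "\<exists>p\<in>#l. odd p" by auto
  obtain a k' where k: "k = add_mset a k'" "odd_plus2 k = add_mset (a + 2) k'" "odd a"
      "\<And>p. p \<in># k' \<Longrightarrow> odd p \<Longrightarrow> p \<le> a"
    using odd_plus2_split[OF ex(1)] by metis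
  obtain b l' where l: "l = add_mset b l'" "odd_plus2 l = add_mset (b + 2) l'" "odd b"
      "\<And>p. p \<in># l' \<Longrightarrow> odd p \<Longrightarrow> p \<le> b"
    using odd_plus2_split[OF ex(2)] by metis
  have both: "add_mset (a + 2) k' = add_mset (b + 2) l'"
    using eq k(2) l(2) by simp
  have "a + 2 \<in># add_mset (b + 2) l'" "b + 2 \<in># add_mset (a + 2) k'"
    using both by (metis union_single_eq_member)+
  then have "a + 2 \<le> b + 2" "b + 2 \<le> a + 2"
    using k(3) k(4)[of "b + 2"] l(3) l(4)[of "a + 2"] by auto
  then show "k = l" using both k(1) l(1) by simp
qed

lemma size_odd_plus2: "\<exists>p\<in>#l. odd p \<Longrightarrow> size (odd_plus2 l) = size l"
  by (erule odd_plus2_split) auto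

lemma size_double_parts: "size (double_parts l) = size l"
  by (simp add: double_parts_def)

lemma inj_double_parts: "inj double_parts"
  unfolding double_parts_def by (intro multiset.inj_map) (simp add: inj_on_def)

lemma even_parts_double_parts: "p \<in># double_parts l \<Longrightarrow> even p"
  by (auto simp: double_parts_def)

text \<open>A raised part is odd and at least \<open>3\<close>, while adjoining \<open>(1,1,1)\<close> to even parts leaves \<open>1\<close> as the
  only odd part.\<close>

lemma disjoint_step:
  assumes "\<And>l. l \<in> A \<Longrightarrow> \<exists>p\<in>#l. odd p" and "\<And>l p. l \<in> B \<Longrightarrow> p \<in># l \<Longrightarrow> even p"
  shows "odd_plus2 ` A \<inter> (\<lambda>l. l + {#1, 1, 1#}) ` B = {}"
proof -
  have False if "l \<in> A" "k \<in> B" and eq: "odd_plus2 l = k + {#1, 1, 1#}" for l k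
  proof -
    obtain m l' where m: "odd_plus2 l = add_mset (m + 2) l'" "odd m"
      using odd_plus2_split[OF assms(1)[OF \<open>l \<in> A\<close>]] by metis
    have "m + 2 \<in># k + {#1, 1, 1#}" using m(1) eq by (metis union_single_eq_member)
    then show False using assms(2)[OF \<open>k \<in> B\<close>, of "m + 2"] m(2) by auto
  qed
  then show ?thesis by blast
qed

lemma card_step:
  assumes "finite A" "finite B"
    and "\<And>l. l \<in> A \<Longrightarrow> \<exists>p\<in>#l. odd p" and "\<And>l p. l \<in> B \<Longrightarrow> p \<in># l \<Longrightarrow> even p"
  shows "card (odd_plus2 ` A \<union> (\<lambda>l. l + {#1, 1, 1#}) ` B) = card A + card B"
proof -
  have "inj_on odd_plus2 A"
    by (rule inj_on_subset[OF inj_on_odd_plus2]) (use assms(3) in auto)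
  then show ?thesis
    using assms(1,2) disjoint_step[of A B] assms(3,4)
    by (subst card_Un_disjoint) (auto simp: card_image inj_on_def)
qed

lemma sum_size_step:
  assumes "finite A" "finite B"
    and "\<And>l. l \<in> A \<Longrightarrow> \<exists>p\<in>#l. odd p" and "\<And>l p. l \<in> B \<Longrightarrow> p \<in># l \<Longrightarrow> even p"
  shows "(\<Sum>l\<in>odd_plus2 ` A \<union> (\<lambda>l. l + {#1, 1, 1#}) ` B. size l) =
    (\<Sum>l\<in>A. size l) + (\<Sum>l\<in>B. size l) + 3 * card B"
proof -
  have inj: "inj_on odd_plus2 A"
    by (rule inj_on_subset[OF inj_on_odd_plus2]) (use assms(3) in auto)
  have "(\<Sum>l\<in>odd_plus2 ` A. size l) = (\<Sum>l\<in>A. size l)"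
    using size_odd_plus2[OF assms(3)] by (simp add: sum.reindex[OF inj])
  moreover have "(\<Sum>l\<in>(\<lambda>l. l + {#1, 1, 1#}) ` B. size l) = (\<Sum>l\<in>B. size l) + 3 * card B"
    by (subst sum.reindex) (auto simp: inj_on_def sum.distrib sum_Suc)
  ultimately show ?thesis
    using assms(1,2) disjoint_step[of A B] assms(3,4)
    by (subst sum.union_disjoint) auto
qed

lemma card_double: "card (double_parts ` A) = card A"
  by (intro card_image inj_on_subset[OF inj_double_parts]) simp

lemma sum_size_double: "(\<Sum>l\<in>double_parts ` A. size l) = (\<Sum>l\<in>A. size l)"
  by (subst sum.reindex) (auto intro: inj_on_subset[OF inj_double_parts] simp: size_double_parts)

lemma SPa_double_counts:
  "card (SPa (2 * m)) = card (SPa m)" "pspa (2 * m) = pspa m"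
  by (cases "m = 0"; simp add: pspa_def card_double sum_size_double)+

lemma SPa'_double_counts:
  "card (SPa' (2 * m)) = card (SPa' m)" "pspa' (2 * m) = pspa' m"
  by (cases "m = 0"; simp add: pspa'_def card_double sum_size_double)+

lemma SPa_even_parts: "l \<in> SPa (2 * m) \<Longrightarrow> p \<in># l \<Longrightarrow> even p"
  by (cases "m = 0") (auto dest: even_parts_double_parts)

lemma SPa'_even_parts: "l \<in> SPa' (2 * m) \<Longrightarrow> p \<in># l \<Longrightarrow> even p"
  by (cases "m = 0") (auto dest: even_parts_double_parts)

lemma SPa_odd_part: "l \<in> SPa (2 * m + 1) \<Longrightarrow> \<exists>p\<in>#l. odd p"
  using SPa_partition[of l "2 * m + 1"] by (intro odd_part_exists) simp

lemma SPa'_odd_part: "l \<in> SPa' (2 * m + 1) \<Longrightarrow> \<exists>p\<in>#l. odd p"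
  using SPa'_partition[of l "2 * m + 1"] by (intro odd_part_exists) simp

lemma card_SPa_odd: "card (SPa (2 * m + 3)) = card (SPa (2 * m + 1)) + card (SPa m)"
proof (cases "m = 0")
  case False
  have "SPa (2 * m + 3) =
      odd_plus2 ` SPa (2 * m + 1) \<union> (\<lambda>l. l + {#1, 1, 1#}) ` SPa (2 * m)"
    using SPa.simps(5)[of "m + 1"] False by (simp add: numeral_3_eq_3)
  then show ?thesis
    using card_step[OF finite_SPa finite_SPa SPa_odd_part SPa_even_parts]
    by (simp only: SPa_double_counts)
qed (use SPa.simps(2) in simp)

text \<open>The recursion for the sets does not give \<open>SPa 3\<close>; the single part of its only
  element \<open>(3)\<close> agrees in parity with the three parts of \<open>(1,1,1)\<close>, whence a congruence
  that includes \<open>m = 0\<close>.\<close>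

lemma pspa_odd: "[pspa (2 * m + 3) = pspa (2 * m + 1) + pspa m + card (SPa m)] (mod 2)"
proof (cases "m = 0")
  case True
  then show ?thesis using SPa.simps(2) by (simp add: pspa_def cong_def)
next
  case False
  have "SPa (2 * m + 3) =
      odd_plus2 ` SPa (2 * m + 1) \<union> (\<lambda>l. l + {#1, 1, 1#}) ` SPa (2 * m)"
    using SPa.simps(5)[of "m + 1"] False by (simp add: numeral_3_eq_3)
  then have "pspa (2 * m + 3) = pspa (2 * m + 1) + pspa (2 * m) + 3 * card (SPa (2 * m))"
    using sum_size_step[OF finite_SPa finite_SPa SPa_odd_part SPa_even_parts]
    by (simp only: pspa_def)
  then have "pspa (2 * m + 3) = pspa (2 * m + 1) + pspa m + 3 * card (SPa m)"
    by (simp only: SPa_double_counts)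
  then show ?thesis unfolding cong_def by presburger
qed

lemma SPa'_odd:
  "SPa' (2 * m + 3) = odd_plus2 ` SPa' (2 * m + 1) \<union> (\<lambda>l. l + {#1, 1, 1#}) ` SPa' (2 * m)"
  using SPa'.simps(4)[of "m + 1"] by (simp add: numeral_3_eq_3)

lemma card_SPa'_odd: "card (SPa' (2 * m + 3)) = card (SPa' (2 * m + 1)) + card (SPa' m)"
  using card_step[OF finite_SPa' finite_SPa' SPa'_odd_part SPa'_even_parts]
  by (simp only: SPa'_odd SPa'_double_counts)

lemma pspa'_odd: "[pspa' (2 * m + 3) = pspa' (2 * m + 1) + pspa' m + card (SPa' m)] (mod 2)"
proof -
  have "pspa' (2 * m + 3) = pspa' (2 * m + 1) + pspa' (2 * m) + 3 * card (SPa' (2 * m))"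
    unfolding pspa'_def SPa'_odd
    by (rule sum_size_step[OF finite_SPa' finite_SPa' SPa'_odd_part SPa'_even_parts])
  then have "pspa' (2 * m + 3) = pspa' (2 * m + 1) + pspa' m + 3 * card (SPa' m)"
    by (simp only: SPa'_double_counts)
  then show ?thesis unfolding cong_def by presburger
qed

text \<open>In the recursion for \<open>c\<close> the number \<open>a\<close> of partitions comes in twice, once from the parts \<open>1\<close>
  adjoined and once from counting the new partitions, and so it drops out.\<close>

lemma cong_add_card:
  fixes a b p x y :: nat
  assumes "[x = y + p + a] (mod 2)"
  shows "[x + (b + a) = y + b + p] (mod 2)"
proof -
  have "[x + (b + a) = (y + p + a) + (b + a)] (mod 2)"
    using assms by (intro cong_add) auto
  also have "(y + p + a) + (b + a) = (y + b + p) + 2 * a"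
    by simp
  also have "[(y + b + p) + 2 * a = y + b + p] (mod 2)"
    by (simp add: cong_def)
  finally show ?thesis .
qed

theorem theorem5p10:
  fixes n :: nat
  assumes "n \<ge> 1"
  shows "[pspa (8 * n + 2) = pspa (8 * n - 5)] (mod 2) \<and>
    [pspa' (8 * n + 2) = pspa' (8 * n - 5)] (mod 2)"
proof -
  obtain k where k: "n = Suc k" using assms by (cases n) auto
  have "[pspa (8 * k + 10) = pspa (8 * k + 3)] (mod 2)"
  proof (rule coupled_recursion_congruence[where c = "\<lambda>m. pspa m + card (SPa m)"])
    fix m
    show "[pspa (2 * m + 3) = pspa (2 * m + 1) + (pspa m + card (SPa m))] (mod 2)"
      using pspa_odd[of m] by (simp only: add.assoc)
    show "[pspa (2 * m + 3) + card (SPa (2 * m + 3)) =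
        pspa (2 * m + 1) + card (SPa (2 * m + 1)) + pspa m] (mod 2)"
      using cong_add_card[OF pspa_odd] by (simp only: card_SPa_odd)
    show "even (pspa 1 + card (SPa 1))"
      unfolding pspa_def SPa.simps(2) by simp
  qed (simp_all only: SPa_double_counts)
  moreover have "[pspa' (8 * k + 10) = pspa' (8 * k + 3)] (mod 2)"
  proof (rule coupled_recursion_congruence[where c = "\<lambda>m. pspa' m + card (SPa' m)"])
    fix m
    show "[pspa' (2 * m + 3) = pspa' (2 * m + 1) + (pspa' m + card (SPa' m))] (mod 2)"
      using pspa'_odd[of m] by (simp only: add.assoc)
    show "[pspa' (2 * m + 3) + card (SPa' (2 * m + 3)) =
        pspa' (2 * m + 1) + card (SPa' (2 * m + 1)) + pspa' m] (mod 2)"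
      using cong_add_card[OF pspa'_odd] by (simp only: card_SPa'_odd)
    show "even (pspa' 1 + card (SPa' 1))"
      unfolding pspa'_def SPa'.simps(2) by simp
  qed (simp_all only: SPa'_double_counts)
  moreover have "8 * n + 2 = 8 * k + 10" "8 * n - 5 = 8 * k + 3" using k by simp_all
  ultimately show ?thesis by (simp only: simp_thms)
qed

end
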